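(* Let $K\subset\mathbb{R}^d$ be a convex body. If the shortest closed generalized billiard trajectory in $K$ (i.e. a closed generalized billiard trajectory in $K$ of minimal length among all closed generalized billiard trajectories in $K$) has precisely $d+1$ bounces, then it is classical.
   Context: A convex body is a compact convex set with nonempty interior; lengths and angles are Euclidean, and the length of a closed polygonal line $(q_1,\dots,q_m)$ is $\sum_{i=1}^m|q_{i+1}-q_i|$ with cyclic indexing. For $q\in\partial K$, the cone of outer normals is $N_K(q)=\{n\in\mathbb{R}^d:\langle n,q'-q\rangle\le 0\ \forall q'\in K\}$. A point $q\in\partial K$ is smooth if $N_K(q)$ is a single ray (the support hyperplane at $q$ is unique), and non-smooth otherwise. Closed generalized billiard trajectory in $K$ with $m\ge 2$ bounces: a closed polygonal line $q_1\to q_2\to\dots\to q_m\to q_1$ with $q_i\in\partial K$ (cyclic indexing) such that for every $i$ the point $q_i$ does not belong to the segment $[q_{i-1},q_{i+1}]$ and the bisector of the angle $\angle q_{i-1}q_iq_{i+1}$ is orthogonal to some support hyperplane of $K$ at $q_i$; equivalently, $\frac{q_i-q_{i-1}}{|q_i-q_{i-1}|}-\frac{q_{i+1}-q_i}{|q_{i+1}-q_i|}$ is a nonzero element of $N_K(q_i)$. The trajectory is classical if all its bounce points $q_i$ are smooth points of $\partial K$. *)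

theory Defs
  imports "HOL-Analysis.Analysis"
begin

definition convex_body :: "'a::euclidean_space set \<Rightarrow> bool" where
  "convex_body K \<longleftrightarrow> compact K \<and> convex K \<and> interior K \<noteq> {}"

definition outer_normal_cone :: "'a::euclidean_space set \<Rightarrow> 'a \<Rightarrow> 'a set" where
  "outer_normal_cone K q = {n. \<forall>q'\<in>K. n \<bullet> (q' - q) \<le> 0}"

(* The apex 0 always belongs to the cone, so the ray is the closed one. *)
definition smooth_point :: "'a::euclidean_space set \<Rightarrow> 'a \<Rightarrow> bool" where
  "smooth_point K q \<longleftrightarrow>
     q \<in> frontier K \<and> (\<exists>n. n \<noteq> 0 \<and> outer_normal_cone K q = {t *\<^sub>R n | t. t \<ge> 0})"

definition support_hyperplane :: "'a::euclidean_space set \<Rightarrow> 'a \<Rightarrow> 'a set \<Rightarrow> bool" where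
  "support_hyperplane K q H \<longleftrightarrow>
     (\<exists>n. n \<noteq> 0 \<and> n \<in> outer_normal_cone K q \<and> H = {x. n \<bullet> (x - q) = 0})"

(* A closed polygonal line is the list of its vertices; indices are read
   cyclically, starting from 0. *)
definition next_vertex :: "'a list \<Rightarrow> nat \<Rightarrow> 'a" where
  "next_vertex qs i = qs ! ((i + 1) mod length qs)"

definition prev_vertex :: "'a list \<Rightarrow> nat \<Rightarrow> 'a" where
  "prev_vertex qs i = qs ! ((i + length qs - 1) mod length qs)"

definition closed_polygon_length :: "'a::euclidean_space list \<Rightarrow> real" where
  "closed_polygon_length qs = (\<Sum>i<length qs. norm (next_vertex qs i - qs ! i))"

(* Direction of the bisector of the angle p q r: the sum of the unit vectors
   pointing from q to p and to r (sgn x is x / norm x).  It is nonzero whenever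
   q does not lie on the segment from p to r. *)
definition bisector_direction :: "'a::euclidean_space \<Rightarrow> 'a \<Rightarrow> 'a \<Rightarrow> 'a" where
  "bisector_direction p q r = sgn (p - q) + sgn (r - q)"

definition orthogonal_to_hyperplane :: "'a::euclidean_space \<Rightarrow> 'a set \<Rightarrow> bool" where
  "orthogonal_to_hyperplane v H \<longleftrightarrow> (\<forall>x\<in>H. \<forall>y\<in>H. orthogonal v (x - y))"

definition generalized_billiard :: "'a::euclidean_space set \<Rightarrow> 'a list \<Rightarrow> bool" where
  "generalized_billiard K qs \<longleftrightarrow>
     length qs \<ge> 2 \<and>
     (\<forall>i<length qs.
        qs ! i \<in> frontier K \<and>
        qs ! i \<notin> closed_segment (prev_vertex qs i) (next_vertex qs i) \<and>
        (\<exists>H. support_hyperplane K (qs ! i) H \<and>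
             orthogonal_to_hyperplane
               (bisector_direction (prev_vertex qs i) (qs ! i) (next_vertex qs i)) H))"

definition shortest_generalized_billiard :: "'a::euclidean_space set \<Rightarrow> 'a list \<Rightarrow> bool" where
  "shortest_generalized_billiard K qs \<longleftrightarrow>
     generalized_billiard K qs \<and>
     (\<forall>qs'. generalized_billiard K qs' \<longrightarrow>
        closed_polygon_length qs \<le> closed_polygon_length qs')"

definition classical_billiard :: "'a::euclidean_space set \<Rightarrow> 'a list \<Rightarrow> bool" where
  "classical_billiard K qs \<longleftrightarrow>
     generalized_billiard K qs \<and> (\<forall>i<length qs. smooth_point K (qs ! i))"

lemma sgn_add_eq_0_imp_in_segment:
  fixes p q r :: "'a::euclidean_space"
  assumes "sgn (p - q) + sgn (r - q) = 0"
  shows "q \<in> closed_segment p r"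
proof -
  define a where "a = norm (p - q)"
  define b where "b = norm (r - q)"
  show ?thesis
  proof (cases "p = q \<or> r = q")
    case True
    then show ?thesis by auto
  next
    case False
    then have ab: "a > 0" "b > 0" by (auto simp: a_def b_def)
    have p: "p - q = a *\<^sub>R sgn (p - q)" and r: "r - q = b *\<^sub>R sgn (r - q)"
      using ab by (auto simp: sgn_div_norm a_def b_def)
    have "sgn (r - q) = - sgn (p - q)"
      using assms by (simp add: eq_neg_iff_add_eq_0 add.commute)
    then have "b *\<^sub>R (p - q) + a *\<^sub>R (r - q) = 0"
      by (subst p, subst r) simp
    then have "(a + b) *\<^sub>R q = b *\<^sub>R p + a *\<^sub>R r"
      by (simp add: algebra_simps)
    then have "inverse (a + b) *\<^sub>R ((a + b) *\<^sub>R q) = inverse (a + b) *\<^sub>R (b *\<^sub>R p + a *\<^sub>R r)"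
      by simp
    then have "q = (b / (a + b)) *\<^sub>R p + (a / (a + b)) *\<^sub>R r"
      using ab by (simp add: scaleR_add_right divide_inverse mult.commute)
    moreover have "1 - a / (a + b) = b / (a + b)" using ab by (simp add: field_simps)
    ultimately show ?thesis
      using ab unfolding closed_segment_def
      by (auto intro!: exI[of _ "a / (a + b)"])
  qed
qed

(* The bisector condition is the reflection law in terms of the normal cone. *)
lemma bisector_condition_iff_normal_cone:
  fixes K :: "'a::euclidean_space set"
  assumes seg: "q \<notin> closed_segment p r" and pK: "p \<in> K"
  shows "(\<exists>H. support_hyperplane K q H \<and>
              orthogonal_to_hyperplane (bisector_direction p q r) H) \<longleftrightarrow>
         sgn (q - p) - sgn (r - q) \<in> outer_normal_cone K q - {0}"
    (is "?L \<longleftrightarrow> _")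
proof -
  define u where "u = sgn (q - p)"
  define w where "w = sgn (r - q)"
  define v where "v = u - w"
  have bis: "bisector_direction p q r = - v"
    using sgn_minus[of "q - p"] by (simp add: bisector_direction_def v_def u_def w_def)
  have v0: "v \<noteq> 0"
  proof
    assume "v = 0"
    then have "sgn (p - q) + sgn (r - q) = 0"
      using bis by (simp add: bisector_direction_def)
    then show False using sgn_add_eq_0_imp_in_segment seg by blast
  qed
  have "?L \<longleftrightarrow> v \<in> outer_normal_cone K q - {0}"
  proof
    assume ?L
    then obtain n where n: "n \<noteq> 0" "n \<in> outer_normal_cone K q"
      and orth: "orthogonal_to_hyperplane (- v) {x. n \<bullet> (x - q) = 0}"
      unfolding support_hyperplane_def bis by auto
    have perp: "v \<bullet> z = 0" if "n \<bullet> z = 0" for z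
    proof -
      have "q + z \<in> {x. n \<bullet> (x - q) = 0}" "q \<in> {x. n \<bullet> (x - q) = 0}" using that by auto
      then have "orthogonal (- v) (q + z - q)"
        using orth unfolding orthogonal_to_hyperplane_def by blast
      then show ?thesis by (simp add: orthogonal_def)
    qed
    define c where "c = (n \<bullet> v) / (n \<bullet> n)"
    define z where "z = v - c *\<^sub>R n"
    have nz: "n \<bullet> z = 0"
      using n by (simp add: c_def z_def inner_diff_right)
    from perp[OF nz] nz have "z \<bullet> z = 0"
      by (subst (1) z_def) (simp add: inner_diff_left)
    then have vc: "v = c *\<^sub>R n" by (simp add: z_def)
    have np: "n \<bullet> (p - q) \<le> 0"
      using n pK by (auto simp: outer_normal_cone_def)
    have qp: "q \<noteq> p" "q \<noteq> r" using seg by auto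
    have pq: "p - q = (- norm (q - p)) *\<^sub>R u"
      using qp by (simp add: u_def sgn_div_norm)
    have uu: "u \<bullet> u = 1" "w \<bullet> w = 1"
      using qp by (auto simp: u_def w_def dot_square_norm norm_sgn)
    have "v \<bullet> v = 2 * (v \<bullet> u)"
      using uu by (simp add: v_def inner_diff_left inner_diff_right inner_commute)
    moreover have "v \<bullet> v > 0" using v0 by simp
    ultimately have "v \<bullet> u > 0" by linarith
    then have "v \<bullet> (p - q) < 0"
      using qp by (subst pq) simp
    then have "c * (n \<bullet> (p - q)) < 0" by (simp add: vc)
    with np have "c > 0" by (auto simp: mult_less_0_iff)
    then have "v \<in> outer_normal_cone K q"
      using n unfolding vc outer_normal_cone_def by (auto simp: mult_le_0_iff)
    with v0 show "v \<in> outer_normal_cone K q - {0}" by blast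
  next
    assume A: "v \<in> outer_normal_cone K q - {0}"
    have "orthogonal_to_hyperplane (- v) {x. v \<bullet> (x - q) = 0}"
      by (auto simp: orthogonal_to_hyperplane_def orthogonal_def inner_diff_right)
    with A show ?L unfolding support_hyperplane_def bis by blast
  qed
  then show ?thesis by (simp add: v_def u_def w_def)
qed

end

theory Submission
  imports Defs
begin

text \<open>
  The proof rests on the Bezdek--Bezdek principle: a shortest closed generalized billiard
  trajectory in a convex body \<open>K\<close> is shortest among all closed polygons that have no translate in
  the interior of \<open>K\<close>.  A polygon without such a translate is called unfitting here; this
  depends on its set of vertices only (\<open>fits_inside\<close>).  By convex duality,
  a finite set of points of \<open>K\<close> is unfitting exactly if one can choose outer normals at its
  points, not all zero, that add up to zero (\<open>not_fits_inside_certificate\<close> and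
  \<open>balanced_normals_exist\<close>); call such a family balanced.

  The vectors of the reflection law along a closed trajectory are normals whose sum telescopes
  to zero, so a trajectory is unfitting (\<open>generalized_billiard_unfitting\<close>).  Conversely, take an
  unfitting polygon that is shortest for its number of vertices and from which no vertex can be
  removed.  Sliding one vertex \<open>y\<close> orthogonally to its normal in a balanced family keeps the
  polygon unfitting, so the derivative of the length in these directions vanishes, and the
  bisector at \<open>y\<close> is parallel to that normal (\<open>shortest_unfitting_reflects\<close>): the polygon is a
  generalized trajectory.  A compactness argument yields such polygons, hence below every
  unfitting polygon there is a trajectory that is not longer
  (\<open>generalized_billiard_below_unfitting\<close>).  So a shortest trajectory is a shortest unfitting
  polygon, and omitting any of its vertices, which shortens it, makes it fit.

  Let such a trajectory have \<open>d + 1\<close> vertices, and let \<open>n\<close> be a balanced family.  No proper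
  subset of the vertices is unfitting, so \<open>0\<close> is no nonnegative combination of the normals with
  some but not all coefficients zero, and therefore the \<open>d\<close> normals away from a chosen vertex \<open>y\<close>
  form a basis (\<open>balanced_normals_span\<close>).  If \<open>m\<close> is any outer normal at \<open>y\<close>, one expands it in
  this basis and finds that \<open>n y + e *\<^sub>R m\<close> with small \<open>e > 0\<close> also belongs to a balanced family,
  after a slight change of the weights of the other normals (\<open>balanced_normals_perturb\<close>).  The
  bisector at \<open>y\<close> is then parallel both to \<open>n y\<close> and to \<open>n y + e *\<^sub>R m\<close>, so \<open>m\<close> is a multiple of
  \<open>n y\<close>, and the normal cone at \<open>y\<close> is a ray.
\<close>

section \<open>Outer normals and translation into the interior\<close>

definition fits_inside :: "'a::euclidean_space set \<Rightarrow> 'a set \<Rightarrow> bool" where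
  "fits_inside K A \<longleftrightarrow> (\<exists>t. \<forall>p\<in>A. p + t \<in> interior K)"

definition balanced_normals :: "'a::euclidean_space set \<Rightarrow> 'a set \<Rightarrow> ('a \<Rightarrow> 'a) \<Rightarrow> bool" where
  "balanced_normals K A n \<longleftrightarrow>
     (\<forall>p\<in>A. n p \<in> outer_normal_cone K p) \<and> (\<Sum>p\<in>A. n p) = 0 \<and> (\<exists>p\<in>A. n p \<noteq> 0)"

lemma fits_inside_subset: "fits_inside K A \<Longrightarrow> B \<subseteq> A \<Longrightarrow> fits_inside K B"
  unfolding fits_inside_def by blast

lemma outer_normal_cone_scaleR:
  "n \<in> outer_normal_cone K q \<Longrightarrow> c \<ge> 0 \<Longrightarrow> c *\<^sub>R n \<in> outer_normal_cone K q"
  by (auto simp: outer_normal_cone_def mult_nonneg_nonpos)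

lemma outer_normal_cone_add:
  "m \<in> outer_normal_cone K q \<Longrightarrow> n \<in> outer_normal_cone K q \<Longrightarrow> m + n \<in> outer_normal_cone K q"
  by (fastforce simp: outer_normal_cone_def inner_add_left)

lemma inner_sgn_self: "n \<bullet> sgn n = norm (n::'a::real_inner)"
  by (cases "n = 0") (simp_all add: sgn_div_norm power2_norm_eq_inner[symmetric] power2_eq_square)

text \<open>
  Going from the centre of the ball by \<open>r\<close> in the direction of the normal does not leave the
  half-space that the normal supports.
\<close>
lemma outer_normal_cball:
  fixes K :: "'a::euclidean_space set"
  assumes n: "n \<in> outer_normal_cone K q" and r: "r \<ge> 0" "cball k r \<subseteq> K"
  shows "n \<bullet> (k - q) \<le> - (r * norm n)"
proof -
  have "k + r *\<^sub>R sgn n \<in> K"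
    using r by (intro subsetD[OF r(2)]) (auto simp: dist_norm norm_sgn)
  then have "n \<bullet> (k + r *\<^sub>R sgn n - q) \<le> 0" using n by (auto simp: outer_normal_cone_def)
  then show ?thesis by (simp add: inner_diff_right inner_add_right inner_sgn_self)
qed

lemma outer_normal_strict_interior:
  fixes K :: "'a::euclidean_space set"
  assumes n: "n \<in> outer_normal_cone K q" "n \<noteq> 0" and k: "k \<in> interior K"
  shows "n \<bullet> (k - q) < 0"
proof -
  obtain e where e: "e > 0" "cball k e \<subseteq> K"
    using k mem_interior_cball by blast
  then have "n \<bullet> (k - q) \<le> - (e * norm n)"
    using n by (intro outer_normal_cball) auto
  also have "\<dots> < 0" using e n by simp
  finally show ?thesis .
qed

text \<open>
  If all \<open>x i + t\<close> were interior, every nonzero \<open>n i\<close> would have negative inner product with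
  \<open>t\<close>, while the normals add up to zero.  The points \<open>x i\<close> may differ from the points \<open>y i\<close> at
  which the normals are taken: this is what makes the certificate survive the sliding of a vertex
  within its support hyperplane.
\<close>
lemma not_fits_inside_certificate:
  fixes K :: "'a::euclidean_space set"
  assumes fin: "finite I"
    and n: "\<And>i. i \<in> I \<Longrightarrow> n i \<in> outer_normal_cone K (y i)"
    and bal: "(\<Sum>i\<in>I. n i) = 0"
    and nz: "j \<in> I" "n j \<noteq> 0"
    and x: "\<And>i. i \<in> I \<Longrightarrow> n i \<bullet> (x i - y i) \<ge> 0"
  shows "\<not> fits_inside K (x ` I)"
proof
  assume "fits_inside K (x ` I)"
  then obtain t where t: "\<And>i. i \<in> I \<Longrightarrow> x i + t \<in> interior K"
    unfolding fits_inside_def by blast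
  have neg: "n i \<bullet> t < 0" if "i \<in> I" "n i \<noteq> 0" for i
  proof -
    have "n i \<bullet> (x i + t - y i) < 0"
      using outer_normal_strict_interior[OF n[OF that(1)] that(2) t[OF that(1)]] .
    then show ?thesis using x[OF that(1)] by (simp add: inner_diff_right inner_add_right)
  qed
  have "(\<Sum>i\<in>I. n i \<bullet> t) < (\<Sum>i\<in>I. 0)"
  proof (rule sum_strict_mono_ex1[OF fin])
    show "\<forall>i\<in>I. n i \<bullet> t \<le> 0"
      using neg by (metis inner_zero_left less_imp_le order_refl)
    show "\<exists>i\<in>I. n i \<bullet> t < 0" using nz neg by blast
  qed
  moreover have "(\<Sum>i\<in>I. n i \<bullet> t) = (\<Sum>i\<in>I. n i) \<bullet> t"
    by (simp add: inner_sum_left)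
  ultimately show False using bal by simp
qed

section \<open>Balanced normals of a set that does not fit\<close>

text \<open>
  If the ray from \<open>p\<close> in direction \<open>v\<close> avoided the interior, a hyperplane separating the two
  would pass through \<open>p\<close> and give a normal at \<open>p\<close> with nonnegative inner product with \<open>v\<close>.
\<close>
lemma direction_into_interior:
  fixes K :: "'a::euclidean_space set"
  assumes K: "convex K" "interior K \<noteq> {}" and p: "p \<in> K"
    and v: "\<And>n. n \<in> outer_normal_cone K p \<Longrightarrow> n \<noteq> 0 \<Longrightarrow> n \<bullet> v < 0"
  shows "\<exists>e>0. \<forall>s. 0 < s \<and> s \<le> e \<longrightarrow> p + s *\<^sub>R v \<in> interior K"
proof -
  define R where "R = (\<lambda>s. p + s *\<^sub>R v) ` {0<..}"
  have "R \<inter> interior K \<noteq> {}"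
  proof
    assume dis: "R \<inter> interior K = {}"
    have "convex R"
    proof -
      have "R = (+) p ` (\<lambda>s. s *\<^sub>R v) ` {0<..}" by (auto simp: R_def image_image)
      moreover have "linear (\<lambda>s::real. s *\<^sub>R v)" by (simp add: linear_iff scaleR_left_distrib)
      ultimately show ?thesis
        by (simp only: convex_translation convex_linear_image convex_real_interval)
    qed
    moreover have "R \<noteq> {}" by (auto simp: R_def)
    moreover have "convex (interior K)" using K by (rule_tac convex_interior)
    ultimately obtain a b where a: "a \<noteq> 0" "\<forall>x\<in>interior K. a \<bullet> x \<le> b" "\<forall>x\<in>R. b \<le> a \<bullet> x"
      using separating_hyperplane_sets[of "interior K" R] K dis by (metis inf_commute)
    have clos: "K \<subseteq> {x. a \<bullet> x \<le> b}"
    proof -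
      have "closure (interior K) \<subseteq> {x. a \<bullet> x \<le> b}"
        using a(2) by (intro closure_minimal) (auto simp: closed_halfspace_le)
      then show ?thesis
        using convex_closure_interior[OF K] closure_subset by blast
    qed
    have far: "b \<le> a \<bullet> p + s * (a \<bullet> v)" if "s > 0" for s
      using a(3) that by (auto simp: R_def inner_add_right)
    \<comment> \<open>Letting \<open>s\<close> tend to zero shows that the separating hyperplane passes through \<open>p\<close>.\<close>
    have lim: "((\<lambda>s. a \<bullet> p + s * (a \<bullet> v)) \<longlongrightarrow> a \<bullet> p + 0 * (a \<bullet> v)) (at_right 0)"
      by (intro tendsto_intros)
    have "b \<le> a \<bullet> p + 0 * (a \<bullet> v)"
      by (rule tendsto_lowerbound[OF lim])
        (auto simp: eventually_at_right_less far eventually_at_filter intro!: always_eventually)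
    then have bp: "b = a \<bullet> p" using clos p by force
    have "a \<in> outer_normal_cone K p"
      using clos bp by (auto simp: outer_normal_cone_def inner_diff_right)
    with v a have "a \<bullet> v < 0" by blast
    with far[of 1] bp show False by simp
  qed
  then obtain e where e: "e > 0" "p + e *\<^sub>R v \<in> interior K" by (auto simp: R_def)
  have "p + s *\<^sub>R v \<in> interior K" if s: "0 < s" "s \<le> e" for s
  proof -
    have "p - (s/e) *\<^sub>R (p - (p + e *\<^sub>R v)) \<in> interior K"
      using s e p by (intro mem_interior_convex_shrink[OF K(1)]) auto
    then show ?thesis using e by simp
  qed
  with e show ?thesis by blast
qed

text \<open>
  If zero is not in the convex hull of the nonzero normals at points of \<open>A\<close>, then the vector that
  separates it from this hull is a direction in which all points of \<open>A\<close> enter the interior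
  simultaneously.  To have a compact hull, the normals are normalised by a fixed interior point
  \<open>k\<close>: the slice \<open>n \<bullet> (k - p) = -1\<close> is a compact convex base of the normal cone at \<open>p\<close>.
  Since each base is convex, a point of the hull of their union uses only one normal per point.
\<close>
lemma balanced_normals_exist:
  fixes K :: "'a::euclidean_space set"
  assumes K: "convex K" "interior K \<noteq> {}" and A: "finite A" "A \<subseteq> K"
    and not: "\<not> fits_inside K A"
  obtains n where "balanced_normals K A n"
proof -
  obtain k r where r: "r > 0" "cball k r \<subseteq> K"
    using K(2) mem_interior_cball by (metis ex_in_conv)
  then have k: "k \<in> interior K" using mem_interior_cball by blast
  define B where "B p = {n \<in> outer_normal_cone K p. n \<bullet> (k - p) = -1}" for p
  have Beq: "B p = (\<Inter>q\<in>K. {n. (q - p) \<bullet> n \<le> 0}) \<inter> {n. (k - p) \<bullet> n = -1}" for p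
    by (auto simp: B_def outer_normal_cone_def inner_commute)
  have convB: "convex (B p)" for p
    unfolding Beq by (intro convex_Int convex_INT convex_halfspace_le convex_hyperplane)
  have closedB: "closed (B p)" for p
    unfolding Beq by (intro closed_Int closed_INT ballI closed_halfspace_le closed_hyperplane)
  have "norm n \<le> 1 / r" if "n \<in> B p" for n p
  proof -
    have "n \<bullet> (k - p) \<le> - (r * norm n)"
      using that r by (intro outer_normal_cball) (auto simp: B_def)
    then have "r * norm n \<le> 1" using that by (simp add: B_def)
    then show ?thesis using r by (simp add: field_simps)
  qed
  then have "bounded (B p)" for p by (meson bounded_iff)
  then have compB: "compact (B p)" for p using closedB compact_eq_bounded_closed by blast
  define A' where "A' = {p \<in> A. B p \<noteq> {}}"
  have normB: "n \<bullet> (k - p) < 0" "(1 / (- (n \<bullet> (k - p)))) *\<^sub>R n \<in> B p"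
    if "n \<in> outer_normal_cone K p" "n \<noteq> 0" for n p
  proof -
    show neg: "n \<bullet> (k - p) < 0" using outer_normal_strict_interior[OF that k] .
    have "(1 / (- (n \<bullet> (k - p)))) *\<^sub>R n \<in> outer_normal_cone K p"
      using neg by (intro outer_normal_cone_scaleR that) simp
    then show "(1 / (- (n \<bullet> (k - p)))) *\<^sub>R n \<in> B p" using neg by (simp add: B_def)
  qed
  define C where "C = convex hull (\<Union>(B ` A'))"
  have finA': "finite A'" using A by (simp add: A'_def)
  have "0 \<in> C"
  proof (rule ccontr)
    assume "0 \<notin> C"
    moreover have "compact C"
      unfolding C_def using finA' compB by (intro compact_convex_hull compact_UN) auto
    moreover have "convex C" by (simp add: C_def)
    ultimately obtain a b where ab: "0 < b" "\<forall>x\<in>C. a \<bullet> x > b"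
      using separating_hyperplane_closed_0[of C] compact_imp_closed by metis
    have "\<exists>e>0. \<forall>s. 0 < s \<and> s \<le> e \<longrightarrow> p + s *\<^sub>R (- a) \<in> interior K" if p: "p \<in> A" for p
    proof (rule direction_into_interior[OF K])
      show "p \<in> K" using p A by blast
      fix n assume n: "n \<in> outer_normal_cone K p" "n \<noteq> 0"
      have "(1 / (- (n \<bullet> (k - p)))) *\<^sub>R n \<in> C"
        unfolding C_def using normB(2)[OF n] p by (intro hull_inc) (auto simp: A'_def)
      then have "0 < a \<bullet> ((1 / (- (n \<bullet> (k - p)))) *\<^sub>R n)" using ab by force
      also have "\<dots> = (a \<bullet> n) / (- (n \<bullet> (k - p)))" by simp
      finally have "a \<bullet> n > 0"
        using normB(1)[OF n] by (simp only: zero_less_divide_iff) linarith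
      then show "n \<bullet> (- a) < 0" by (simp add: inner_commute)
    qed
    then obtain e where e: "\<And>p. p \<in> A \<Longrightarrow> e p > 0"
      "\<And>p s. p \<in> A \<Longrightarrow> 0 < s \<Longrightarrow> s \<le> e p \<Longrightarrow> p + s *\<^sub>R (- a) \<in> interior K"
      by metis
    \<comment> \<open>The added \<open>1\<close> covers the case of an empty \<open>A\<close>.\<close>
    define s where "s = Min (insert 1 (e ` A))"
    have "s > 0" "\<And>p. p \<in> A \<Longrightarrow> s \<le> e p"
      using A e(1) by (auto simp: s_def)
    then have "fits_inside K A" unfolding fits_inside_def using e(2) by blast
    with not show False by blast
  qed
  then obtain c w where cw: "0 = (\<Sum>p\<in>A'. c p *\<^sub>R w p)" "\<forall>p\<in>A'. c p \<ge> 0" "sum c A' = 1"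
      "\<forall>p\<in>A'. w p \<in> B p"
    unfolding C_def using convex_hull_finite_union[OF finA', of B] convB
    by (auto simp: A'_def)
  define n where "n p = (if p \<in> A' then c p *\<^sub>R w p else 0)" for p
  have "balanced_normals K A n"
    unfolding balanced_normals_def
  proof (intro conjI ballI)
    show "n p \<in> outer_normal_cone K p" for p
    proof (cases "p \<in> A'")
      case True
      then have "w p \<in> outer_normal_cone K p" using cw by (auto simp: B_def)
      then show ?thesis using cw True by (simp add: n_def outer_normal_cone_scaleR)
    qed (simp add: n_def outer_normal_cone_def)
    have "(\<Sum>p\<in>A. n p) = (\<Sum>p\<in>A'. n p)"
      using A by (intro sum.mono_neutral_right) (auto simp: A'_def n_def)
    also have "\<dots> = (\<Sum>p\<in>A'. c p *\<^sub>R w p)" by (simp add: n_def)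
    finally show "(\<Sum>p\<in>A. n p) = 0" using cw by simp
    obtain p where p: "p \<in> A'" "c p \<noteq> 0"
      using cw(3) sum.neutral[of A' c] by fastforce
    then have "w p \<noteq> 0" using cw(4) by (auto simp: B_def)
    then show "\<exists>p\<in>A. n p \<noteq> 0" using p by (auto simp: n_def A'_def)
  qed
  then show thesis by (rule that)
qed

section \<open>Lengths of closed polygons\<close>

definition open_length :: "'a::euclidean_space list \<Rightarrow> real" where
  "open_length ps = (\<Sum>i<length ps - 1. norm (ps ! (i + 1) - ps ! i))"

lemma closed_polygon_length_eq_open_length:
  assumes "ps \<noteq> []"
  shows "closed_polygon_length ps = open_length ps + norm (hd ps - last ps)"
proof -
  obtain n where n: "length ps = Suc n" using assms by (cases ps) auto
  have "closed_polygon_length ps =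
      (\<Sum>i<n. norm (next_vertex ps i - ps ! i)) + norm (next_vertex ps n - ps ! n)"
    by (simp add: closed_polygon_length_def n)
  also have "(\<Sum>i<n. norm (next_vertex ps i - ps ! i)) = open_length ps"
    by (simp add: open_length_def n next_vertex_def)
  also have "next_vertex ps n - ps ! n = hd ps - last ps"
    using assms by (simp add: next_vertex_def n hd_conv_nth last_conv_nth)
  finally show ?thesis .
qed

lemma open_length_snoc:
  assumes "ps \<noteq> []"
  shows "open_length (ps @ [y]) = open_length ps + norm (y - last ps)"
proof -
  obtain n where n: "length ps = Suc n" using assms by (cases ps) auto
  have "open_length (ps @ [y]) = (\<Sum>i<n. norm ((ps @ [y]) ! (i + 1) - (ps @ [y]) ! i))
      + norm ((ps @ [y]) ! (n + 1) - (ps @ [y]) ! n)"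
    by (simp add: open_length_def n)
  also have "(\<Sum>i<n. norm ((ps @ [y]) ! (i + 1) - (ps @ [y]) ! i)) = open_length ps"
    by (simp add: open_length_def n nth_append)
  finally show ?thesis using assms by (simp add: n nth_append last_conv_nth)
qed

lemma open_length_Cons:
  assumes "ps \<noteq> []"
  shows "open_length (y # ps) = norm (hd ps - y) + open_length ps"
proof -
  obtain n where n: "length ps = Suc n" using assms by (cases ps) auto
  show ?thesis
    using assms by (simp add: open_length_def n sum.lessThan_Suc_shift hd_conv_nth del: sum.lessThan_Suc)
qed

lemma closed_polygon_length_snoc:
  assumes "ps \<noteq> []"
  shows "closed_polygon_length (ps @ [y]) = open_length ps + norm (y - last ps) + norm (hd ps - y)"
  using assms by (simp add: closed_polygon_length_eq_open_length open_length_snoc)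

lemma closed_polygon_length_append_commute:
  "closed_polygon_length (xs @ ys) = closed_polygon_length (ys @ xs)"
proof (induction xs arbitrary: ys)
  case (Cons x xs)
  have rot: "closed_polygon_length (x # ps) = closed_polygon_length (ps @ [x])" for ps :: "'a list"
    by (cases "ps = []")
      (simp_all add: closed_polygon_length_eq_open_length open_length_Cons open_length_snoc
        norm_minus_commute)
  show ?case using Cons.IH[of "ys @ [x]"] rot[of "xs @ ys"] by simp
qed simp

text \<open>
  Cutting a closed polygon open at a vertex \<open>y\<close> leaves the path \<open>zs @ xs\<close>, which begins after
  \<open>y\<close> and ends before \<open>y\<close>.  In this form cyclic indices are no longer needed.
\<close>
lemma neighbours_of_split:
  fixes qs :: "'a::euclidean_space list"
  assumes qs: "qs = xs @ y # zs" and ne: "zs @ xs \<noteq> []"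
  shows "prev_vertex qs (length xs) = last (zs @ xs)" "next_vertex qs (length xs) = hd (zs @ xs)"
proof -
  show "prev_vertex qs (length xs) = last (zs @ xs)"
  proof (cases xs rule: rev_cases)
    case Nil
    then show ?thesis using ne by (cases zs rule: rev_cases) (auto simp: qs prev_vertex_def nth_append)
  next
    case (snoc us u)
    then have "length xs + length qs - 1 = length us + length qs" "length us < length qs"
      by (simp_all add: qs)
    then have "(length xs + length qs - 1) mod length qs = length us" by simp
    then show ?thesis by (simp add: prev_vertex_def) (simp add: qs snoc nth_append)
  qed
  show "next_vertex qs (length xs) = hd (zs @ xs)"
  proof (cases zs)
    case Nil
    then show ?thesis using ne by (cases xs) (auto simp: qs next_vertex_def)
  qed (simp add: qs next_vertex_def nth_append)
qed

lemma split_at_vertex: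
  fixes qs :: "'a::euclidean_space list"
  assumes i: "i < length qs" and len: "length qs \<ge> 2"
  obtains xs zs where "qs = xs @ qs ! i # zs" "zs @ xs \<noteq> []"
    "prev_vertex qs i = last (zs @ xs)" "next_vertex qs i = hd (zs @ xs)"
proof -
  have split: "qs = take i qs @ qs ! i # drop (Suc i) qs" using i by (rule id_take_nth_drop)
  have ne: "drop (Suc i) qs @ take i qs \<noteq> []" using i len by auto
  have "length (take i qs) = i" using i by simp
  then show thesis using neighbours_of_split[OF split ne] that[OF split ne] by simp
qed

lemma norm_diff_le_closed_polygon_length:
  assumes "i < length ps"
  shows "norm (ps ! i - ps ! 0) \<le> closed_polygon_length ps"
proof -
  have "ps ! i - ps ! 0 = (\<Sum>j<i. ps ! Suc j - ps ! j)"
    by (simp add: sum_lessThan_telescope)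
  also have "norm \<dots> \<le> (\<Sum>j<i. norm (ps ! Suc j - ps ! j))" by (rule norm_sum)
  also have "\<dots> = (\<Sum>j<i. norm (next_vertex ps j - ps ! j))"
    using assms by (intro sum.cong) (auto simp: next_vertex_def)
  also have "\<dots> \<le> closed_polygon_length ps"
    unfolding closed_polygon_length_def using assms by (intro sum_mono2) auto
  finally show ?thesis .
qed

lemma next_vertex_map: "i < length ps \<Longrightarrow> next_vertex (map f ps) i = f (next_vertex ps i)"
  unfolding next_vertex_def length_map by (intro nth_map mod_less_divisor) linarith

lemma closed_polygon_length_translate:
  "closed_polygon_length (map (\<lambda>p. p + t) ps) = closed_polygon_length ps"
  by (simp add: closed_polygon_length_def next_vertex_map)

lemma closed_polygon_length_scale:
  assumes "s \<ge> 0"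
  shows "closed_polygon_length (map (\<lambda>p. s *\<^sub>R p) ps) = s * closed_polygon_length ps"
  using assms by (simp add: closed_polygon_length_def next_vertex_map sum_distrib_left
      scaleR_diff_right[symmetric])

section \<open>Existence of shortest unfitting polygons\<close>

lemma fits_inside_translate: "fits_inside K ((\<lambda>p. p + t) ` A) \<longleftrightarrow> fits_inside K A"
proof
  show "fits_inside K ((\<lambda>p. p + t) ` A) \<Longrightarrow> fits_inside K A"
    by (auto simp: fits_inside_def add.assoc)
  assume "fits_inside K A"
  then obtain s where "\<forall>p\<in>A. p + s \<in> interior K" by (auto simp: fits_inside_def)
  then show "fits_inside K ((\<lambda>p. p + t) ` A)"
    unfolding fits_inside_def by (intro exI[of _ "s - t"]) auto
qed

text \<open>
  Competitors have the same number of vertices, but these may coincide, so that polygons with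
  fewer vertices are included as degenerate cases.
\<close>
definition shortest_unfitting :: "'a::euclidean_space set \<Rightarrow> 'a list \<Rightarrow> bool" where
  "shortest_unfitting K qs \<longleftrightarrow> \<not> fits_inside K (set qs) \<and>
     (\<forall>qs'. length qs' = length qs \<longrightarrow> \<not> fits_inside K (set qs') \<longrightarrow>
        closed_polygon_length qs \<le> closed_polygon_length qs')"

text \<open>
  Up to translation the first vertex is the origin, so only polygons in a ball whose radius is
  the given length \<open>L\<close> compete.  Unfitting polygons form a closed set, because fitting is an open
  condition; hence the length attains its minimum.  Polygons are treated as points of the
  product space \<open>nat \<Rightarrow> 'a\<close>, whose coordinates from \<open>k\<close> on play the role of padding.
\<close>
lemma shortest_unfitting_exists:
  fixes K :: "'a::euclidean_space set"
  assumes qs: "\<not> fits_inside K (set qs)" "qs \<noteq> []"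
  obtains ps where "length ps = length qs" "shortest_unfitting K ps"
proof -
  define k where "k = length qs"
  have k: "k > 0" using qs by (simp add: k_def)
  define L where "L = closed_polygon_length qs"
  define g where "g f = (\<Sum>i<k. norm (f ((i + 1) mod k) - f i))" for f :: "nat \<Rightarrow> 'a"
  define S where "S = (\<Pi>\<^sub>E i\<in>UNIV. cball (0::'a) L) \<inter> {f. \<not> fits_inside K (f ` {..<k})}"
  have "compactin (product_topology (\<lambda>i. euclidean) UNIV) (\<Pi>\<^sub>E i\<in>(UNIV::nat set). cball (0::'a) L)"
    by (subst compactin_PiE) auto
  then have "compact (\<Pi>\<^sub>E i\<in>(UNIV::nat set). cball (0::'a) L)"
    by (simp add: euclidean_product_topology)
  moreover have "closed {f::nat \<Rightarrow> 'a. \<not> fits_inside K (f ` {..<k})}"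
  proof -
    have "{f::nat \<Rightarrow> 'a. fits_inside K (f ` {..<k})} =
        (\<Union>t. \<Inter>i\<in>{..<k}. (\<lambda>f. f i + t) -` interior K)"
      by (auto simp: fits_inside_def)
    moreover have "open ((\<lambda>f::nat \<Rightarrow> 'a. f i + t) -` interior K)" for i t
      by (intro open_vimage continuous_intros continuous_on_product_coordinates) auto
    ultimately have "open {f::nat \<Rightarrow> 'a. fits_inside K (f ` {..<k})}"
      by (simp only:) (intro open_UN ballI open_INT finite_lessThan)
    then show ?thesis by (simp add: closed_def Collect_neg_eq[symmetric])
  qed
  ultimately have "compact S" unfolding S_def by (rule compact_Int_closed)
  moreover have "continuous_on S g"
    unfolding g_def by (intro continuous_intros continuous_on_subset[OF continuous_on_product_coordinates]) auto
  moreover have normalise: "\<exists>f\<in>S. g f = closed_polygon_length ps"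
    if ps: "length ps = k" "\<not> fits_inside K (set ps)" "closed_polygon_length ps \<le> L" for ps
  proof
    define f where "f i = (if i < k then ps ! i + (- ps ! 0) else 0)" for i
    have "norm (ps ! i - ps ! 0) \<le> L" if "i < k" for i
      using norm_diff_le_closed_polygon_length[of i ps] ps that by simp
    moreover have "0 \<le> L" using calculation[of 0] k norm_ge_zero order_trans by blast
    ultimately have "f i \<in> cball 0 L" for i by (simp add: f_def)
    moreover have "f ` {..<k} = (\<lambda>p. p + (- ps ! 0)) ` set ps"
      using ps by (force simp: f_def set_conv_nth)
    then have "\<not> fits_inside K (f ` {..<k})" using ps by (simp only: fits_inside_translate) simp
    ultimately show "f \<in> S" by (auto simp: S_def)
    show "g f = closed_polygon_length ps"
      using k ps by (simp add: g_def closed_polygon_length_def f_def next_vertex_def)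
  qed
  moreover have "S \<noteq> {}" using normalise[of qs] qs by (auto simp: k_def L_def)
  ultimately obtain f where f: "f \<in> S" "\<And>f'. f' \<in> S \<Longrightarrow> g f \<le> g f'"
    using continuous_attains_inf[of S g] by blast
  define ps where "ps = map f [0..<k]"
  have len: "length ps = k" by (simp add: ps_def)
  have "closed_polygon_length ps = g f"
    using k by (simp add: g_def closed_polygon_length_def next_vertex_def ps_def)
  moreover have "set ps = f ` {..<k}" by (auto simp: ps_def)
  moreover have "g f \<le> closed_polygon_length ps'"
    if ps': "length ps' = k" "\<not> fits_inside K (set ps')" for ps'
  proof (cases "closed_polygon_length ps' \<le> L")
    case True
    then show ?thesis using normalise[of ps'] ps' f(2) by force
  next
    case False
    moreover have "g f \<le> L" using normalise[of qs] qs f(2) by (force simp: k_def L_def)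
    ultimately show ?thesis by simp
  qed
  ultimately have "shortest_unfitting K ps"
    using f(1) by (auto simp: shortest_unfitting_def len S_def)
  with len show thesis by (intro that) (auto simp: k_def)
qed

text \<open>
  A copy shrunk by a factor \<open>s < 1\<close> is strictly shorter and so fits into the interior by some
  translation; a limit of these translations for \<open>s\<close> tending to one moves the polygon itself into
  \<open>K\<close>.  The length must be positive for this, and it is, since a one-point polygon fits.
\<close>
lemma shortest_unfitting_translates_into:
  fixes K :: "'a::euclidean_space set"
  assumes K: "compact K" "interior K \<noteq> {}" and ps: "shortest_unfitting K ps" "ps \<noteq> []"
  obtains t where "\<And>p. p \<in> set ps \<Longrightarrow> p + t \<in> K"
proof -
  have nofit: "\<not> fits_inside K (set ps)" using ps by (simp add: shortest_unfitting_def)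
  have pos: "closed_polygon_length ps > 0"
  proof (rule ccontr)
    assume "\<not> ?thesis"
    then have "ps ! i = ps ! 0" if "i < length ps" for i
      using norm_diff_le_closed_polygon_length[OF that] by (meson norm_le_zero_iff not_less order_trans right_minus_eq)
    then have "set ps \<subseteq> {ps ! 0}" by (auto simp: set_conv_nth)
    moreover obtain k where "k \<in> interior K" using K by blast
    then have "fits_inside K {ps ! 0}"
      unfolding fits_inside_def by (intro exI[of _ "k - ps ! 0"]) auto
    ultimately show False using nofit fits_inside_subset by blast
  qed
  define s where "s j = 1 - inverse (real (Suc j))" for j
  have "fits_inside K ((\<lambda>p. s j *\<^sub>R p) ` set ps)" for j
  proof (rule ccontr)
    assume "\<not> ?thesis"
    then have "closed_polygon_length ps \<le> closed_polygon_length (map (\<lambda>p. s j *\<^sub>R p) ps)"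
      using ps(1) by (simp add: shortest_unfitting_def)
    also have "s j \<ge> 0" by (simp add: s_def field_simps)
    then have "closed_polygon_length (map (\<lambda>p. s j *\<^sub>R p) ps) = s j * closed_polygon_length ps"
      by (rule closed_polygon_length_scale)
    also have "\<dots> < 1 * closed_polygon_length ps"
      using pos by (intro mult_strict_right_mono) (auto simp: s_def)
    finally show False by simp
  qed
  then obtain t where t: "\<And>j p. p \<in> set ps \<Longrightarrow> s j *\<^sub>R p + t j \<in> K"
    unfolding fits_inside_def using interior_subset by (metis imageI subsetD)
  have s1: "s \<longlonglongrightarrow> 1"
    unfolding s_def using tendsto_diff[OF tendsto_const LIMSEQ_inverse_real_of_nat, of 1] by simp
  have p0: "hd ps \<in> set ps" using ps by simp
  then obtain l r where lr: "strict_mono r" "((\<lambda>j. s j *\<^sub>R hd ps + t j) \<circ> r) \<longlonglongrightarrow> l"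
    using K(1) t unfolding compact_def by meson
  have sr: "(\<lambda>j. s (r j)) \<longlonglongrightarrow> 1"
    using LIMSEQ_subseq_LIMSEQ[OF s1 lr(1)] by (simp add: comp_def)
  have tr: "(\<lambda>j. t (r j)) \<longlonglongrightarrow> l - 1 *\<^sub>R hd ps"
    using tendsto_diff[OF lr(2) tendsto_scaleR[OF sr tendsto_const[of "hd ps"]]]
    by (simp add: comp_def)
  show thesis
  proof (rule that)
    fix p assume p: "p \<in> set ps"
    have "(\<lambda>j. s (r j) *\<^sub>R p + t (r j)) \<longlonglongrightarrow> 1 *\<^sub>R p + (l - 1 *\<^sub>R hd ps)"
      by (intro tendsto_intros sr tr)
    then show "p + (l - hd ps) \<in> K"
      using closed_sequentially[OF compact_imp_closed[OF K(1)], of "\<lambda>j. s (r j) *\<^sub>R p + t (r j)"] t[OF p]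
      by simp
  qed
qed

section \<open>The reflection law for shortest unfitting polygons\<close>

text \<open>
  Removal acts on list positions, so a repeated point counts as several vertices; hence an
  unfitting polygon with this property has distinct vertices.
\<close>
definition irredundant :: "'a::euclidean_space set \<Rightarrow> 'a list \<Rightarrow> bool" where
  "irredundant K qs \<longleftrightarrow> (\<forall>xs y zs. qs = xs @ y # zs \<longrightarrow> fits_inside K (set (xs @ zs)))"

lemma irredundant_distinct:
  assumes "irredundant K qs" "\<not> fits_inside K (set qs)"
  shows "distinct qs"
proof (rule ccontr)
  assume "\<not> distinct qs"
  then obtain xs ys zs y where qs: "qs = xs @ [y] @ ys @ [y] @ zs"
    using not_distinct_decomp by blast
  then have "fits_inside K (set (xs @ (ys @ [y] @ zs)))"
    using assms(1) unfolding irredundant_def by (metis append_Cons append_Nil)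
  moreover have "set (xs @ ys @ [y] @ zs) = set qs" by (auto simp: qs)
  ultimately show False using assms(2) by simp
qed

lemma irredundant_psubset:
  assumes "irredundant K qs" "A \<subset> set qs"
  shows "fits_inside K A"
proof -
  obtain y where y: "y \<in> set qs" "y \<notin> A" using assms by blast
  then obtain xs zs where qs: "qs = xs @ y # zs" by (meson split_list)
  then have "A \<subseteq> set (xs @ zs)" using assms y by auto
  moreover have "fits_inside K (set (xs @ zs))" using assms qs by (auto simp: irredundant_def)
  ultimately show ?thesis using fits_inside_subset by blast
qed

text \<open>
  A zero normal could be dropped, leaving a certificate that a proper subset does not fit.
\<close>
lemma balanced_normals_nonzero:
  assumes A: "finite A" "\<And>B. B \<subset> A \<Longrightarrow> fits_inside K B"
    and n: "balanced_normals K A n" and p: "p \<in> A"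
  shows "n p \<noteq> 0"
proof
  assume "n p = 0"
  define B where "B = {p \<in> A. n p \<noteq> 0}"
  have "B \<subset> A" using p \<open>n p = 0\<close> by (auto simp: B_def)
  obtain j where j: "j \<in> B" "n j \<noteq> 0" using n by (auto simp: balanced_normals_def B_def)
  have "(\<Sum>p\<in>B. n p) = (\<Sum>p\<in>A. n p)"
    using A(1) by (intro sum.mono_neutral_left) (auto simp: B_def)
  then have "\<not> fits_inside K ((\<lambda>p. p) ` B)"
    using n A(1) by (intro not_fits_inside_certificate[of B n K "\<lambda>p. p" j] j)
      (auto simp: balanced_normals_def B_def)
  then show False using A(2)[OF \<open>B \<subset> A\<close>] by simp
qed

lemma parallel_if_orthogonal_complement:
  fixes u n :: "'a::real_inner"
  assumes "\<And>v. n \<bullet> v = 0 \<Longrightarrow> u \<bullet> v = 0"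
  obtains c where "u = c *\<^sub>R n"
proof (cases "n = 0")
  case True
  then have "u \<bullet> u = 0" using assms[of u] by simp
  then show ?thesis using that[of 0] by simp
next
  case False
  define c where "c = (n \<bullet> u) / (n \<bullet> n)"
  define v where "v = u - c *\<^sub>R n"
  have nv: "n \<bullet> v = 0" using False by (simp add: c_def v_def inner_diff_right)
  with assms have "v \<bullet> v = 0" by (subst (1) v_def) (simp add: inner_diff_left)
  then show ?thesis by (intro that[of c]) (simp add: v_def)
qed

lemma length_first_variation:
  fixes p y r v :: "'a::euclidean_space"
  assumes ne: "y \<noteq> p" "y \<noteq> r"
    and min: "\<And>t. norm (y - p) + norm (r - y)
               \<le> norm (y + t *\<^sub>R v - p) + norm (r - (y + t *\<^sub>R v))"
  shows "bisector_direction p y r \<bullet> v = 0"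
proof -
  define g where "g t = norm (y + t *\<^sub>R v - p) + norm (r - (y + t *\<^sub>R v))" for t
  have 1: "((\<lambda>t. norm (y + t *\<^sub>R v - p)) has_derivative (\<lambda>h. (h *\<^sub>R v) \<bullet> sgn (y - p))) (at 0)"
    by (rule has_derivative_compose[of "\<lambda>t. y + t *\<^sub>R v - p" "\<lambda>h. h *\<^sub>R v" 0 UNIV norm
          "\<lambda>x. x \<bullet> sgn (y - p)"])
      (use ne has_derivative_norm[of "y - p"] in \<open>auto intro!: derivative_eq_intros\<close>)
  have 2: "((\<lambda>t. norm (r - (y + t *\<^sub>R v))) has_derivative (\<lambda>h. (- (h *\<^sub>R v)) \<bullet> sgn (r - y))) (at 0)"
    by (rule has_derivative_compose[of "\<lambda>t. r - (y + t *\<^sub>R v)" "\<lambda>h. - (h *\<^sub>R v)" 0 UNIV norm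
          "\<lambda>x. x \<bullet> sgn (r - y)"])
      (use ne has_derivative_norm[of "r - y"] in \<open>auto intro!: derivative_eq_intros\<close>)
  have "(g has_derivative (\<lambda>h. (h *\<^sub>R v) \<bullet> sgn (y - p) + (- (h *\<^sub>R v)) \<bullet> sgn (r - y))) (at 0)"
    unfolding g_def by (rule has_derivative_add[OF 1 2])
  moreover have "(\<lambda>h. (h *\<^sub>R v) \<bullet> sgn (y - p) + (- (h *\<^sub>R v)) \<bullet> sgn (r - y))
      = (*) (v \<bullet> sgn (y - p) - v \<bullet> sgn (r - y))"
    by (auto simp: algebra_simps)
  ultimately have "DERIV g 0 :> v \<bullet> sgn (y - p) - v \<bullet> sgn (r - y)"
    by (simp add: has_field_derivative_def)
  moreover have "\<forall>t. \<bar>0 - t\<bar> < 1 \<longrightarrow> g 0 \<le> g t" using min by (simp add: g_def)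
  ultimately have "v \<bullet> sgn (y - p) - v \<bullet> sgn (r - y) = 0"
    by (intro DERIV_local_min[of g _ 0 1]) simp_all
  moreover have "sgn (p - y) = - sgn (y - p)" using sgn_minus[of "y - p"] by simp
  ultimately show ?thesis
    by (simp add: bisector_direction_def inner_diff_right inner_commute)
qed

text \<open>
  Sliding \<open>y\<close> to \<open>y + t *\<^sub>R v\<close> with \<open>v\<close> orthogonal to \<open>n y\<close> leaves \<open>n\<close> a certificate of not
  fitting, so the length has a minimum at \<open>t = 0\<close> and the bisector is orthogonal to every such
  \<open>v\<close>.  The conclusion holds for every balanced family; using it for two families at once is
  what gives smoothness in the end.
\<close>
lemma shortest_unfitting_reflects:
  fixes K :: "'a::euclidean_space set"
  assumes short: "shortest_unfitting K qs" and irr: "irredundant K qs"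
    and qs: "qs = xs @ y # zs" and ne: "zs @ xs \<noteq> []"
    and n: "balanced_normals K (set qs) n"
  obtains c where "bisector_direction (last (zs @ xs)) y (hd (zs @ xs)) = c *\<^sub>R n y"
proof -
  define ps where "ps = zs @ xs"
  have "distinct qs"
    using irredundant_distinct[OF irr] short by (simp add: shortest_unfitting_def)
  then have y: "y \<notin> set ps" by (auto simp: ps_def qs)
  have "bisector_direction (last ps) y (hd ps) \<bullet> v = 0" if v: "n y \<bullet> v = 0" for v
  proof (rule length_first_variation)
    show "y \<noteq> last ps" using y ne last_in_set by (metis ps_def)
    show "y \<noteq> hd ps" using y ne hd_in_set by (metis ps_def)
    fix t
    define x where "x p = (if p = y then y + t *\<^sub>R v else p)" for p
    have "\<not> fits_inside K (x ` set qs)"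
    proof -
      obtain j where "j \<in> set qs" "n j \<noteq> 0" using n by (auto simp: balanced_normals_def)
      then show ?thesis
        using n v by (intro not_fits_inside_certificate[of "set qs" n K "\<lambda>p. p" j x])
          (auto simp: balanced_normals_def x_def)
    qed
    moreover have "x ` set qs = set (ps @ [y + t *\<^sub>R v])"
    proof -
      have "x ` set ps = (\<lambda>p. p) ` set ps" using y by (intro image_cong) (auto simp: x_def)
      moreover have "set qs = insert y (set ps)" by (auto simp: qs ps_def)
      moreover have "x y = y + t *\<^sub>R v" by (simp add: x_def)
      ultimately show ?thesis by simp
    qed
    moreover have "length (ps @ [y + t *\<^sub>R v]) = length qs" by (simp add: qs ps_def)
    ultimately have "closed_polygon_length qs \<le> closed_polygon_length (ps @ [y + t *\<^sub>R v])"
      using short by (metis shortest_unfitting_def)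
    moreover have "closed_polygon_length qs = closed_polygon_length (ps @ [y])"
      using closed_polygon_length_append_commute[of "xs @ [y]" zs]
        closed_polygon_length_append_commute[of "zs @ xs" "[y]"]
        closed_polygon_length_append_commute[of xs "y # zs"]
      by (simp add: qs ps_def)
    ultimately show "norm (y - last ps) + norm (hd ps - y)
        \<le> norm (y + t *\<^sub>R v - last ps) + norm (hd ps - (y + t *\<^sub>R v))"
      using ne by (simp add: ps_def[symmetric] closed_polygon_length_snoc)
  qed
  then obtain c where "bisector_direction (last ps) y (hd ps) = c *\<^sub>R n y"
    using parallel_if_orthogonal_complement by blast
  then show thesis by (intro that[of c]) (simp add: ps_def)
qed

lemma fits_inside_insert_segment:
  assumes "convex K" "fits_inside K A" "p \<in> A" "r \<in> A" "y \<in> closed_segment p r"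
  shows "fits_inside K (insert y A)"
proof -
  obtain t where t: "\<And>a. a \<in> A \<Longrightarrow> a + t \<in> interior K"
    using assms by (auto simp: fits_inside_def)
  have "t + y \<in> closed_segment (t + p) (t + r)"
    using assms(5) by (simp add: closed_segment_translation)
  moreover have "closed_segment (t + p) (t + r) \<subseteq> interior K"
    using t[OF assms(3)] t[OF assms(4)] assms(1)
    by (intro closed_segment_subset convex_interior) (auto simp: add.commute)
  ultimately have "y + t \<in> interior K" by (auto simp: add.commute)
  with t show ?thesis unfolding fits_inside_def by auto
qed

text \<open>
  The reflection law comes from the first variation.  Irredundancy supplies what is missing: all
  normals of a balanced family are nonzero, so the vertices are boundary points, and no vertex
  lies between its neighbours, since a translation that moves both neighbours into the convex
  interior would move this vertex there too.
\<close>
lemma critical_is_generalized_billiard: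
  fixes K :: "'a::euclidean_space set"
  assumes K: "convex_body K"
    and short: "shortest_unfitting K qs" and irr: "irredundant K qs"
    and len: "length qs \<ge> 2" and sub: "set qs \<subseteq> K"
  shows "generalized_billiard K qs"
  unfolding generalized_billiard_def
proof (intro conjI len allI impI)
  fix i assume i: "i < length qs"
  have K': "convex K" "interior K \<noteq> {}" "compact K" using K by (auto simp: convex_body_def)
  have unfit: "\<not> fits_inside K (set qs)" using short by (simp add: shortest_unfitting_def)
  define y where "y = qs ! i"
  obtain xs zs where qs: "qs = xs @ y # zs" and ne: "zs @ xs \<noteq> []"
    and nb: "prev_vertex qs i = last (zs @ xs)" "next_vertex qs i = hd (zs @ xs)"
    using split_at_vertex[OF i len] unfolding y_def by blast
  obtain n where n: "balanced_normals K (set qs) n"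
    using balanced_normals_exist[OF K'(1,2) _ sub unfit] by auto
  have "y \<in> set qs" using i by (simp add: y_def)
  have ny: "n y \<noteq> 0"
    using balanced_normals_nonzero[OF _ _ n \<open>y \<in> set qs\<close>] irredundant_psubset[OF irr] by auto
  have nyK: "n y \<in> outer_normal_cone K y"
    using n \<open>y \<in> set qs\<close> by (auto simp: balanced_normals_def)
  have "y \<notin> interior K" using outer_normal_strict_interior[OF nyK ny, of y] by auto
  then show "qs ! i \<in> frontier K"
    using sub \<open>y \<in> set qs\<close> closure_subset by (auto simp: frontier_def y_def[symmetric])
  show "qs ! i \<notin> closed_segment (prev_vertex qs i) (next_vertex qs i)"
  proof
    assume "qs ! i \<in> closed_segment (prev_vertex qs i) (next_vertex qs i)"
    then have "y \<in> closed_segment (last (zs @ xs)) (hd (zs @ xs))"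
      by (simp add: nb y_def)
    moreover have "fits_inside K (set (zs @ xs))"
      using irr qs by (auto simp: irredundant_def Un_commute)
    ultimately have "fits_inside K (insert y (set (zs @ xs)))"
      using fits_inside_insert_segment[OF K'(1)] ne last_in_set hd_in_set by blast
    moreover have "insert y (set (zs @ xs)) = set qs" by (auto simp: qs)
    ultimately show False using unfit by simp
  qed
  obtain c where c: "bisector_direction (last (zs @ xs)) y (hd (zs @ xs)) = c *\<^sub>R n y"
    using shortest_unfitting_reflects[OF short irr qs ne n] .
  have "orthogonal_to_hyperplane (c *\<^sub>R n y) {x. n y \<bullet> (x - y) = 0}"
    by (auto simp: orthogonal_to_hyperplane_def orthogonal_def inner_diff_right)
  then show "\<exists>H. support_hyperplane K (qs ! i) H \<and>
      orthogonal_to_hyperplane (bisector_direction (prev_vertex qs i) (qs ! i) (next_vertex qs i)) H"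
    using ny nyK c by (auto simp: support_hyperplane_def nb y_def[symmetric])
qed

section \<open>Generalized trajectories and shortest unfitting polygons\<close>

lemma closed_polygon_length_remove_le:
  assumes "zs @ xs \<noteq> []"
  shows "closed_polygon_length (xs @ zs) \<le> closed_polygon_length (xs @ y # zs)" (is ?le)
    and "y \<notin> closed_segment (last (zs @ xs)) (hd (zs @ xs)) \<Longrightarrow>
         closed_polygon_length (xs @ zs) < closed_polygon_length (xs @ y # zs)" (is "_ \<Longrightarrow> ?less")
proof -
  define ps where "ps = zs @ xs"
  have 1: "closed_polygon_length (xs @ zs) = open_length ps + dist (last ps) (hd ps)"
    using closed_polygon_length_eq_open_length[of ps] assms
    by (simp add: closed_polygon_length_append_commute[of xs] ps_def dist_norm norm_minus_commute)
  have 2: "closed_polygon_length (xs @ y # zs) = open_length ps + (dist (last ps) y + dist y (hd ps))"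
    using closed_polygon_length_snoc[of ps y] assms
      closed_polygon_length_append_commute[of "zs @ xs" "[y]"]
      closed_polygon_length_append_commute[of xs "y # zs"]
    by (simp add: ps_def dist_norm norm_minus_commute)
  show ?le using dist_triangle[of "last ps" "hd ps" y] by (simp add: 1 2)
  show ?less if "y \<notin> closed_segment (last (zs @ xs)) (hd (zs @ xs))"
  proof -
    have "dist (last ps) (hd ps) \<noteq> dist (last ps) y + dist y (hd ps)"
      using that between[of "last ps" "hd ps" y] by (simp add: ps_def between_mem_segment)
    then show ?thesis using dist_triangle[of "last ps" "hd ps" y] by (simp add: 1 2)
  qed
qed

text \<open>
  Pass to a shortest unfitting polygon.  If one of its vertices can be removed so that the rest is
  still unfitting, induct on the number of vertices; otherwise a translate of it into \<open>K\<close> is a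
  generalized trajectory.
\<close>
lemma generalized_billiard_below_unfitting:
  fixes K :: "'a::euclidean_space set"
  assumes K: "convex_body K" and unfit: "\<not> fits_inside K (set qs)"
  obtains bs where "generalized_billiard K bs"
    "closed_polygon_length bs \<le> closed_polygon_length qs"
proof -
  have K': "convex K" "interior K \<noteq> {}" "compact K" using K by (auto simp: convex_body_def)
  have "\<exists>bs. generalized_billiard K bs \<and> closed_polygon_length bs \<le> closed_polygon_length qs"
    using unfit
  proof (induction "length qs" arbitrary: qs rule: less_induct)
    case less
    have "qs \<noteq> []" using less.prems by (auto simp: fits_inside_def)
    then obtain ps where ps: "length ps = length qs" "shortest_unfitting K ps"
      using shortest_unfitting_exists less.prems by blast
    have ps_le: "closed_polygon_length ps \<le> closed_polygon_length qs"
      using ps less.prems by (simp add: shortest_unfitting_def)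
    show ?case
    proof (cases "irredundant K ps")
      case False
      then obtain xs y zs where split: "ps = xs @ y # zs" "\<not> fits_inside K (set (xs @ zs))"
        by (auto simp: irredundant_def)
      then have "zs @ xs \<noteq> []" by (auto simp: fits_inside_def)
      then have "closed_polygon_length (xs @ zs) \<le> closed_polygon_length ps"
        using closed_polygon_length_remove_le(1) split by blast
      moreover have "length (xs @ zs) < length qs" using ps split by auto
      ultimately show ?thesis using less.hyps[OF _ split(2)] ps_le by fastforce
    next
      case True
      have "ps \<noteq> []" using ps \<open>qs \<noteq> []\<close> by auto
      then obtain t where t: "\<And>p. p \<in> set ps \<Longrightarrow> p + t \<in> K"
        using shortest_unfitting_translates_into[OF K'(3,2) ps(2)] by blast
      define bs where "bs = map (\<lambda>p. p + t) ps"
      have len: "length bs = length ps"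
        and cpl: "closed_polygon_length bs = closed_polygon_length ps"
        by (simp_all add: bs_def closed_polygon_length_translate)
      have "shortest_unfitting K bs"
        using ps(2) by (simp add: shortest_unfitting_def len cpl) (simp add: bs_def fits_inside_translate)
      moreover have "irredundant K bs"
        unfolding irredundant_def
      proof (intro allI impI)
        fix xs y zs assume "bs = xs @ y # zs"
        then obtain xs' y' zs' where "ps = xs' @ y' # zs'"
          "xs = map (\<lambda>p. p + t) xs'" "zs = map (\<lambda>p. p + t) zs'"
          unfolding bs_def by (auto simp: map_eq_append_conv map_eq_Cons_conv)
        then show "fits_inside K (set (xs @ zs))"
          using True fits_inside_translate[of K t "set (xs' @ zs')"]
          by (auto simp: irredundant_def image_Un)
      qed
      moreover have "length bs \<ge> 2"
      proof (rule ccontr)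
        assume "\<not> ?thesis"
        then obtain p where "ps = [p]" using \<open>ps \<noteq> []\<close> len by (cases ps) (auto simp: Suc_le_eq)
        moreover obtain k where "k \<in> interior K" using K' by blast
        then have "fits_inside K {p}"
          unfolding fits_inside_def by (intro exI[of _ "k - p"]) auto
        ultimately show False using ps by (simp add: shortest_unfitting_def)
      qed
      moreover have "set bs \<subseteq> K" using t by (auto simp: bs_def)
      ultimately have "generalized_billiard K bs"
        by (rule critical_is_generalized_billiard[OF K])
      with cpl ps_le show ?thesis by auto
    qed
  qed
  then show thesis using that by blast
qed

text \<open>
  The normal at a bounce point is the incoming minus the outgoing unit direction, and the outgoing
  direction at one bounce is the incoming one at the next; so these normals add up to zero.
\<close>
lemma generalized_billiard_unfitting:
  fixes K :: "'a::euclidean_space set"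
  assumes K: "convex_body K" and qs: "generalized_billiard K qs"
  shows "\<not> fits_inside K (set qs)"
proof -
  define m where "m = length qs"
  have m: "m \<ge> 2" using qs by (simp add: generalized_billiard_def m_def)
  have "closed K" using K by (simp add: convex_body_def compact_imp_closed)
  then have inK: "qs ! i \<in> K" if "i < m" for i
    using qs that by (auto simp: generalized_billiard_def m_def frontier_def)
  define e where "e i = sgn (next_vertex qs i - qs ! i)" for i
  define pr where "pr i = (i + m - 1) mod m" for i
  define n where "n i = sgn (qs ! i - prev_vertex qs i) - sgn (next_vertex qs i - qs ! i)" for i
  have nextpr: "(pr i + 1) mod m = i" if "i < m" for i
    using that m by (cases i) (auto simp: pr_def)
  have n_alt: "n i = e (pr i) - e i" if "i < m" for i
  proof -
    have "next_vertex qs (pr i) = qs ! i"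
      using nextpr[OF that] by (simp add: next_vertex_def m_def)
    moreover have "prev_vertex qs i = qs ! pr i"
      by (simp add: prev_vertex_def pr_def m_def)
    ultimately show ?thesis by (simp add: n_def e_def)
  qed
  have "inj_on pr {..<m}" using nextpr by (metis inj_onI lessThan_iff)
  moreover have "pr ` {..<m} \<subseteq> {..<m}" using m by (auto simp: pr_def)
  ultimately have "bij_betw pr {..<m} {..<m}"
    by (simp add: bij_betw_def endo_inj_surj)
  then have "(\<Sum>i<m. e (pr i)) = (\<Sum>i<m. e i)" by (rule sum.reindex_bij_betw)
  then have sum0: "(\<Sum>i<m. n i) = 0" by (simp add: n_alt sum_subtractf)
  have ni: "n i \<in> outer_normal_cone K (qs ! i) - {0}" if i: "i < m" for i
  proof -
    have "prev_vertex qs i \<in> K" unfolding prev_vertex_def m_def[symmetric] using m by (intro inK mod_less_divisor) simp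
    then show ?thesis
      using bisector_condition_iff_normal_cone[of "qs ! i" "prev_vertex qs i" "next_vertex qs i" K]
        qs i by (auto simp: generalized_billiard_def m_def n_def)
  qed
  have "\<not> fits_inside K ((!) qs ` {..<m})"
    using m ni sum0 by (intro not_fits_inside_certificate[of "{..<m}" n K "(!) qs" 0]) auto
  moreover have "(!) qs ` {..<m} = set qs" by (auto simp: m_def set_conv_nth)
  ultimately show ?thesis by simp
qed

text \<open>
  No unfitting polygon is shorter than the trajectory.  Removing a vertex makes it strictly
  shorter, because a bounce point is not on the segment between its neighbours; so the result
  must fit.
\<close>
lemma shortest_generalized_billiard_critical:
  fixes K :: "'a::euclidean_space set"
  assumes K: "convex_body K" and qs: "shortest_generalized_billiard K qs"
  shows "shortest_unfitting K qs" "irredundant K qs"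
proof -
  have gb: "generalized_billiard K qs" using qs by (simp add: shortest_generalized_billiard_def)
  have le: "closed_polygon_length qs \<le> closed_polygon_length ps"
    if "\<not> fits_inside K (set ps)" for ps
    using generalized_billiard_below_unfitting[OF K that] qs
    by (metis order_trans shortest_generalized_billiard_def)
  show "shortest_unfitting K qs"
    using generalized_billiard_unfitting[OF K gb] le by (simp add: shortest_unfitting_def)
  show "irredundant K qs"
    unfolding irredundant_def
  proof (intro allI impI)
    fix xs y zs assume decomp: "qs = xs @ y # zs"
    have len: "length qs \<ge> 2" using gb by (simp add: generalized_billiard_def)
    then have ne: "zs @ xs \<noteq> []" using decomp by auto
    have "qs ! length xs \<notin> closed_segment (prev_vertex qs (length xs)) (next_vertex qs (length xs))"
    proof -
      have "length xs < length qs" by (simp add: decomp)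
      then show ?thesis using gb unfolding generalized_billiard_def by blast
    qed
    then have "y \<notin> closed_segment (last (zs @ xs)) (hd (zs @ xs))"
      unfolding neighbours_of_split[OF decomp ne] by (simp add: decomp)
    then show "fits_inside K (set (xs @ zs))"
      using closed_polygon_length_remove_le(2)[OF ne, of y] le[of "xs @ zs"] decomp by force
  qed
qed

section \<open>Smoothness at all bounce points\<close>

text \<open>
  The \<open>d\<close> normals away from \<open>p\<close> are linearly independent: if \<open>c\<close> is a linear relation among them
  with a positive coefficient, subtract from the balanced family the multiple of \<open>c\<close> at which the
  first weight drops to zero.  The result is again balanced, as the weight at \<open>p\<close> is unchanged,
  but has a zero normal, which minimality of \<open>A\<close> forbids.
\<close>
lemma balanced_normals_span:
  fixes K :: "'a::euclidean_space set"
  assumes A: "finite A" "\<And>B. B \<subset> A \<Longrightarrow> fits_inside K B" "card A = DIM('a) + 1"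
    and n: "balanced_normals K A n" and p: "p \<in> A"
  obtains a where "m = (\<Sum>q\<in>A - {p}. a q *\<^sub>R n q)"
proof -
  define A' where "A' = A - {p}"
  have A': "finite A'" "card A' = DIM('a)" "p \<notin> A'" "A = insert p A'"
    using A p by (auto simp: A'_def)
  have nonpos: "c q \<le> 0"
    if c: "(\<Sum>q\<in>A'. c q *\<^sub>R n q) = 0" and q: "q \<in> A'" for c q
  proof (rule ccontr)
    assume pos: "\<not> c q \<le> 0"
    \<comment> \<open>The weights \<open>1 - s * c q\<close> are all nonnegative up to \<open>s = 1 / M\<close>.\<close>
    define M where "M = Max (c ` A')"
    have M: "\<And>q. q \<in> A' \<Longrightarrow> c q \<le> M" "M \<in> c ` A'"
      using A' q by (auto simp: M_def intro!: Max_in)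
    then have "M > 0" using pos q by force
    define n' where "n' q = (if q = p then n p else (1 - c q / M) *\<^sub>R n q)" for q
    have "(\<Sum>q\<in>A'. n' q) = (\<Sum>q\<in>A'. n q - (1 / M) *\<^sub>R (c q *\<^sub>R n q))"
      using A'(3) by (intro sum.cong) (auto simp: n'_def scaleR_left_diff_distrib)
    also have "\<dots> = (\<Sum>q\<in>A'. n q)"
      by (simp only: sum_subtractf scaleR_sum_right[symmetric] c) simp
    finally have "(\<Sum>q\<in>A. n' q) = (\<Sum>q\<in>A. n q)"
      using A' by (simp add: n'_def)
    moreover have "n' q \<in> outer_normal_cone K q" if "q \<in> A" for q
    proof (cases "q = p")
      case False
      then have "c q \<le> M" using M A' that by auto
      then show ?thesis
        using n that False \<open>M > 0\<close> by (auto simp: n'_def balanced_normals_def intro!: outer_normal_cone_scaleR)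
    qed (use n that in \<open>auto simp: n'_def balanced_normals_def\<close>)
    moreover have "n' p \<noteq> 0" using balanced_normals_nonzero[OF A(1,2) n p] by (simp add: n'_def)
    ultimately have "balanced_normals K A n'"
      using n p by (auto simp: balanced_normals_def)
    moreover obtain q' where "q' \<in> A'" "c q' = M" using M(2) by auto
    ultimately show False
      using balanced_normals_nonzero[OF A(1,2), of n' q'] A' \<open>M > 0\<close> by (auto simp: n'_def split: if_splits)
  qed
  have indep: "c q = 0" if c: "(\<Sum>q\<in>A'. c q *\<^sub>R n q) = 0" and q: "q \<in> A'" for c q
    using nonpos[OF c q] nonpos[of "\<lambda>q. - c q", OF _ q] c by (simp add: sum_negf)
  have inj: "inj_on n A'"
  proof (rule inj_onI, rule ccontr)
    fix q r assume qr: "q \<in> A'" "r \<in> A'" "n q = n r" "q \<noteq> r"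
    define c where "c x = (if x = q then 1 else if x = r then -1 else 0 :: real)" for x
    have "(\<Sum>x\<in>A'. c x *\<^sub>R n x) = (\<Sum>x\<in>{q, r}. c x *\<^sub>R n x)"
      using A' qr by (intro sum.mono_neutral_right) (auto simp: c_def)
    also have "\<dots> = 0" using qr by (simp add: c_def)
    finally show False using indep[OF _ qr(1)] by (force simp: c_def)
  qed
  have "independent (n ` A')"
  proof (rule independent_if_scalars_zero)
    show "finite (n ` A')" using A' by simp
    fix f x assume "(\<Sum>x\<in>n ` A'. f x *\<^sub>R x) = 0" "x \<in> n ` A'"
    then show "f x = 0" using indep[of "f \<circ> n"] by (auto simp: sum.reindex[OF inj])
  qed
  moreover have "card (n ` A') = DIM('a)" using A' inj by (simp add: card_image)
  ultimately have "(UNIV::'a set) \<subseteq> span (n ` A')"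
    by (intro card_ge_dim_independent) auto
  then have "m \<in> span (n ` A')" by blast
  then obtain u where "m = (\<Sum>v\<in>n ` A'. u v *\<^sub>R v)"
    using span_finite[of "n ` A'"] A' by auto
  then have "m = (\<Sum>q\<in>A'. u (n q) *\<^sub>R n q)" by (simp add: sum.reindex[OF inj])
  then show thesis unfolding A'_def by (rule that)
qed

text \<open>
  Adding a small multiple of \<open>m\<close> at \<open>p\<close> is compensated by small changes of the weights at the
  other points, and these weights stay positive.
\<close>
lemma balanced_normals_perturb:
  fixes K :: "'a::euclidean_space set"
  assumes A: "finite A" "p \<in> A" and n: "balanced_normals K A n"
    and m: "m \<in> outer_normal_cone K p" "m = (\<Sum>q\<in>A - {p}. a q *\<^sub>R n q)"
    and np: "\<exists>q\<in>A - {p}. n q \<noteq> 0"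
  obtains e n' where "e > 0" "balanced_normals K A n'" "n' p = n p + e *\<^sub>R m"
proof -
  \<comment> \<open>Any bound strictly above all \<open>a q\<close> and zero would do.\<close>
  define M where "M = 1 + (\<Sum>q\<in>A. \<bar>a q\<bar>)"
  have M: "a q < M" if "q \<in> A" for q
    using member_le_sum[of q A "\<lambda>q. \<bar>a q\<bar>"] that A by (simp add: M_def)
  have "M > 0" by (simp add: M_def add_pos_nonneg sum_nonneg)
  define n' where "n' q = (if q = p then n p + (1 / M) *\<^sub>R m else (1 - a q / M) *\<^sub>R n q)" for q
  have "(\<Sum>q\<in>A - {p}. n' q) = (\<Sum>q\<in>A - {p}. n q - (1 / M) *\<^sub>R (a q *\<^sub>R n q))"
    by (intro sum.cong) (auto simp: n'_def scaleR_left_diff_distrib)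
  also have "\<dots> = (\<Sum>q\<in>A - {p}. n q) - (1 / M) *\<^sub>R m"
    by (simp only: sum_subtractf scaleR_sum_right[symmetric] m(2))
  finally have "(\<Sum>q\<in>A. n' q) = (\<Sum>q\<in>A. n q)"
    using A by (simp add: sum.remove[of A p] n'_def)
  moreover have "n' q \<in> outer_normal_cone K q" if "q \<in> A" for q
    using n m(1) that M[OF that] \<open>M > 0\<close>
    by (auto simp: n'_def balanced_normals_def intro!: outer_normal_cone_scaleR outer_normal_cone_add)
  moreover obtain q where "q \<in> A" "q \<noteq> p" "n q \<noteq> 0" using np by blast
  then have "q \<in> A" "n' q \<noteq> 0" using M[of q] \<open>M > 0\<close> by (auto simp: n'_def)
  ultimately have "balanced_normals K A n'" using n by (auto simp: balanced_normals_def)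
  then show thesis using \<open>M > 0\<close> by (intro that[of "1 / M" n']) (auto simp: n'_def)
qed

theorem theorem1p4:
  fixes K :: "'a::euclidean_space set" and qs :: "'a list"
  assumes "convex_body K"
    and "shortest_generalized_billiard K qs"
    and "length qs = DIM('a) + 1"
  shows "classical_billiard K qs"
  unfolding classical_billiard_def
proof (intro conjI allI impI)
  have K: "convex K" "interior K \<noteq> {}" "closed K"
    using assms(1) by (auto simp: convex_body_def compact_imp_closed)
  show gb: "generalized_billiard K qs"
    using assms(2) by (simp add: shortest_generalized_billiard_def)
  then have len: "length qs \<ge> 2" by (simp add: generalized_billiard_def)
  note crit = shortest_generalized_billiard_critical[OF assms(1,2)]
  have unfit: "\<not> fits_inside K (set qs)" using crit(1) by (simp add: shortest_unfitting_def)
  have front: "q \<in> frontier K" if "q \<in> set qs" for q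
    using gb that by (auto simp: generalized_billiard_def in_set_conv_nth)
  then have sub: "set qs \<subseteq> K" using K(3) frontier_subset_closed by blast
  obtain n where n: "balanced_normals K (set qs) n"
    using balanced_normals_exist[OF K(1,2) _ sub unfit] by auto
  have psub: "\<And>B. B \<subset> set qs \<Longrightarrow> fits_inside K B" by (rule irredundant_psubset[OF crit(2)])
  have card: "card (set qs) = DIM('a) + 1"
    using irredundant_distinct[OF crit(2) unfit] assms(3) by (simp add: distinct_card)
  fix i assume i: "i < length qs"
  define y where "y = qs ! i"
  obtain xs zs where qs: "qs = xs @ y # zs" and ne: "zs @ xs \<noteq> []"
    and nb: "prev_vertex qs i = last (zs @ xs)" "next_vertex qs i = hd (zs @ xs)"
    using split_at_vertex[OF i len] unfolding y_def by blast
  have y: "y \<in> set qs" using i by (simp add: y_def)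
  have nz: "n q \<noteq> 0" if "q \<in> set qs" for q
    using balanced_normals_nonzero[OF _ psub n that] by simp
  define b where "b = bisector_direction (last (zs @ xs)) y (hd (zs @ xs))"
  have "b \<noteq> 0"
    using gb i sgn_add_eq_0_imp_in_segment[of "last (zs @ xs)" y "hd (zs @ xs)"]
    by (auto simp: generalized_billiard_def nb y_def b_def bisector_direction_def)
  obtain c where c: "b = c *\<^sub>R n y"
    using shortest_unfitting_reflects[OF crit qs ne n] by (auto simp: b_def)
  have nyK: "n y \<in> outer_normal_cone K y" using n y by (auto simp: balanced_normals_def)
  obtain k where k: "k \<in> interior K" using K(2) by blast
  have "outer_normal_cone K y = {t *\<^sub>R n y | t. t \<ge> 0}"
  proof (intro equalityI subsetI)
    fix m assume m: "m \<in> outer_normal_cone K y"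
    obtain a where a: "m = (\<Sum>q\<in>set qs - {y}. a q *\<^sub>R n q)"
      using balanced_normals_span[OF _ psub card n y] by auto
    have "card (set qs - {y}) > 0" using card y by simp
    then obtain q where "q \<in> set qs - {y}" by (auto simp: card_gt_0_iff)
    then obtain e n' where n': "e > 0" "balanced_normals K (set qs) n'" "n' y = n y + e *\<^sub>R m"
      using balanced_normals_perturb[OF _ y n m a] nz by blast
    \<comment> \<open>The bisector is the same for both families, so \<open>n y\<close> and \<open>n y + e *\<^sub>R m\<close> are parallel.\<close>
    obtain c' where c': "b = c' *\<^sub>R (n y + e *\<^sub>R m)"
      using shortest_unfitting_reflects[OF crit qs ne n'(2)] by (auto simp: b_def n'(3))
    define s where "s = (c / c' - 1) / e"
    have "c' \<noteq> 0" using c' \<open>b \<noteq> 0\<close> by auto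
    then have "n y + e *\<^sub>R m = (c / c') *\<^sub>R n y"
      using c c' by (metis divide_inverse_commute left_inverse scaleR_one scaleR_scaleR)
    then have "e *\<^sub>R m = (c / c' - 1) *\<^sub>R n y" by (simp add: algebra_simps)
    then have "(1 / e) *\<^sub>R (e *\<^sub>R m) = (1 / e) *\<^sub>R ((c / c' - 1) *\<^sub>R n y)" by simp
    then have ms: "m = s *\<^sub>R n y" using n'(1) by (simp add: s_def)
    \<comment> \<open>A negative multiple of \<open>n y\<close> is not a normal, because \<open>K\<close> has an interior point.\<close>
    have neg: "n y \<bullet> (k - y) < 0" using outer_normal_strict_interior[OF nyK nz[OF y] k] .
    have "k \<in> K" using k interior_subset by blast
    then have "s * (n y \<bullet> (k - y)) \<le> 0" using m by (auto simp: ms outer_normal_cone_def)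
    then have "s \<ge> 0" using neg by (auto simp: mult_le_0_iff)
    with ms show "m \<in> {t *\<^sub>R n y | t. t \<ge> 0}" by blast
  qed (auto intro: outer_normal_cone_scaleR nyK)
  then show "smooth_point K (qs ! i)"
    using front[OF y] nz[OF y] by (auto simp: smooth_point_def y_def[symmetric])
qed

end
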